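(* Let $0<q<p\le1$, $k\in\mathbb{Z}$, $n\ge0$. Then $$E_{n,p,q}^{(k)}(x)=\sum_{l=0}^\infty \sum_{i=l}^n \binom ni S_2(i,l)\, E_{n-i,p,q}^{(k)}(-l)\,(x)^{(l)},$$ where $(x)^{(l)}=x(x+1)\cdots(x+l-1)$ for $l\ge1$ and $(x)^{(0)}=1$.
   Context: $[n]_{p,q}=\frac{p^n-q^n}{p-q}$; $\mathrm{Li}_{k,p,q}(t)=\sum_{n\ge1} t^n/[n]_{p,q}^k$. The $(p,q)$-poly-Euler polynomials are defined by $\frac{2\,\mathrm{Li}_{k,p,q}(1-e^{-t})}{1+e^{t}}e^{xt}=\sum_{n\ge0} E_{n,p,q}^{(k)}(x)\frac{t^n}{n!}$. The Stirling numbers of the second kind are defined by $\frac{(e^x-1)^m}{m!}=\sum_{n\ge m}S_2(n,m)\frac{x^n}{n!}$. *)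

theory Defs
  imports
    "HOL-Combinatorics.Stirling"
    "HOL-Computational_Algebra.Formal_Power_Series"
    Complex_Main
begin

definition pq_bracket :: "real \<Rightarrow> real \<Rightarrow> nat \<Rightarrow> real" where
  "pq_bracket p q n = (p ^ n - q ^ n) / (p - q)"

text \<open>
  The generating functions are formal power series in \<open>t\<close>. The coefficient ring is an arbitrary
  real normed field, so that the argument \<open>x\<close> of the polynomials may be real or complex.
\<close>

definition pq_polylog :: "int \<Rightarrow> real \<Rightarrow> real \<Rightarrow> 'a::real_normed_field fps" where
  "pq_polylog k p q =
     Abs_fps (\<lambda>n. if n = 0 then 0 else of_real (1 / (pq_bracket p q n) powi k))"

definition pq_poly_Euler_gf ::
    "int \<Rightarrow> real \<Rightarrow> real \<Rightarrow> 'a::real_normed_field \<Rightarrow> 'a fps" where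
  "pq_poly_Euler_gf k p q x =
     2 * (pq_polylog k p q oo (1 - fps_exp (- 1))) / (1 + fps_exp 1) * fps_exp x"

definition pq_poly_Euler ::
    "int \<Rightarrow> real \<Rightarrow> real \<Rightarrow> nat \<Rightarrow> 'a::real_normed_field \<Rightarrow> 'a" where
  "pq_poly_Euler k p q n x = fact n * fps_nth (pq_poly_Euler_gf k p q x) n"

lemma pq_poly_Euler_generating_function:
  "pq_poly_Euler_gf k p q x = Abs_fps (\<lambda>n. pq_poly_Euler k p q n x / fact n)"
  by (simp add: fps_eq_iff pq_poly_Euler_def)

lemma Stirling_generating_function:
  "fps_const (1 / fact m) * (fps_exp 1 - 1) ^ m =
     Abs_fps (\<lambda>n. of_nat (Stirling n m) / fact n :: 'a::field_char_0)"
proof -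
  define F :: "nat \<Rightarrow> 'a fps" where
    "F m = fps_const (1 / fact m) * (fps_exp 1 - 1) ^ m" for m
  have F0: "F 0 = 1"
    by (simp add: F_def)
  have deriv: "fps_deriv (F (Suc m)) = of_nat (Suc m) * F (Suc m) + F m" for m
  proof -
    define w :: "'a fps" where "w = fps_exp 1 - 1"
    have w': "fps_deriv w = w + 1"
      by (simp add: w_def)
    have c: "of_nat (Suc m) * fps_const (1 / fact (Suc m)) = fps_const (1 / fact m :: 'a)"
      by (simp add: fps_of_nat [symmetric] del: of_nat_Suc)
    have "fps_deriv (F (Suc m)) =
        fps_const (1 / fact (Suc m)) * (of_nat (Suc m) * (w + 1) * w ^ m)"
      by (simp add: F_def w_def [symmetric] fps_deriv_power w' fps_of_nat del: of_nat_Suc fact_Suc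
          power_Suc)
    also have "\<dots> = of_nat (Suc m) * F (Suc m) +
        of_nat (Suc m) * fps_const (1 / fact (Suc m)) * w ^ m"
      by (simp add: F_def w_def [symmetric] algebra_simps del: of_nat_Suc fact_Suc)
    also have "of_nat (Suc m) * fps_const (1 / fact (Suc m)) * w ^ m = F m"
      unfolding c by (simp add: F_def w_def)
    finally show ?thesis .
  qed
  have "fps_nth (F m) n * fact n = of_nat (Stirling n m)" for n
  proof (induction n arbitrary: m)
    case 0
    show ?case
      by (cases m) (simp_all add: F_def)
  next
    case (Suc n)
    show ?case
    proof (cases m)
      case 0
      then show ?thesis by (simp add: F0)
    next
      case (Suc j)
      have "fps_nth (F (Suc j)) (Suc n) * fact (Suc n) = fps_nth (fps_deriv (F (Suc j))) n * fact n"
        by (simp add: algebra_simps)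
      also have "\<dots> = of_nat (Suc j) * (fps_nth (F (Suc j)) n * fact n) + fps_nth (F j) n * fact n"
        unfolding deriv by (simp add: algebra_simps fps_of_nat [symmetric] del: of_nat_Suc)
      also have "\<dots> = of_nat (Stirling (Suc n) (Suc j))"
        by (simp only: Suc.IH) (simp add: algebra_simps)
      finally show ?thesis by (simp only: Suc)
    qed
  qed
  then show ?thesis
    by (simp add: fps_eq_iff F_def [symmetric] field_simps)
qed

end

theory Submission
  imports Defs
begin

text \<open>
  The generating function is \<open>A(t) exp(xt)\<close> with \<open>A\<close> independent of \<open>x\<close>. By the binomial series,
  \<open>exp(xt) = (1 - (1 - exp(-t)))^(-x)\<close> is the sum over \<open>l\<close> of \<open>(x)^(l) (1 - exp(-t))^l / l!\<close>, where
  \<open>(x)^(l)\<close> is the rising factorial, and \<open>(1 - exp(-t))^l / l! = exp(-lt) (exp(t) - 1)^l / l!\<close> is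
  \<open>exp(-lt)\<close> times the Stirling generating function. Since \<open>1 - exp(-t)\<close> has no constant term, only
  \<open>l \<le> n\<close> contributes to the coefficient of \<open>t^n\<close>.
\<close>

text \<open>The binomial series \<open>P\<close> of (1 - u)^(-x) satisfies (1 - u) P' = x P.
  Substituting \<open>v\<close>, for which v' = 1 - v, gives F' = x F for F = \<open>P oo v\<close>,
  which determines F up to its constant term.\<close>

lemma fps_exp_eq_pochhammer_compose:
  fixes x :: "'a::field_char_0"
  shows "fps_exp x = Abs_fps (\<lambda>l. pochhammer x l / fact l) oo (1 - fps_exp (- 1))"
proof -
  define P where "P = Abs_fps (\<lambda>l. pochhammer x l / fact l)"
  define v :: "'a fps" where "v = 1 - fps_exp (- 1)"
  have v0: "fps_nth v 0 = 0"
    by (simp add: v_def)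
  have v': "fps_deriv v = 1 - v"
    by (simp add: v_def fps_eq_iff)
  have P': "(1 - fps_X) * fps_deriv P = fps_const x * P"
  proof (rule fps_ext)
    fix n
    have "fps_nth (fps_deriv P) n = (x + of_nat n) * fps_nth P n"
      by (simp add: P_def pochhammer_Suc del: of_nat_Suc)
    moreover have "fps_nth (fps_X * fps_deriv P) n = of_nat n * fps_nth P n"
      by (cases n) simp_all
    ultimately show "fps_nth ((1 - fps_X) * fps_deriv P) n = fps_nth (fps_const x * P) n"
      by (simp add: left_diff_distrib distrib_right del: fps_deriv_nth)
  qed
  have "fps_deriv (P oo v) = (fps_deriv P oo v) * (1 - v)"
    by (simp add: fps_compose_deriv v0 v')
  also have "\<dots> = ((1 - fps_X) * fps_deriv P) oo v"
    by (simp add: fps_compose_mult_distrib v0 fps_compose_sub_distrib)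
  also have "\<dots> = fps_const x * (P oo v)"
    by (simp add: P' fps_compose_mult_distrib v0)
  finally have "P oo v = fps_const (fps_nth (P oo v) 0) * fps_exp x"
    by (simp only: fps_exp_unique_ODE)
  \<comment> \<open>The constant term is that of \<open>P\<close>, namely 1, since \<open>v\<close>
    has none.\<close>
  then show ?thesis
    by (simp add: P_def v_def)
qed

lemma fps_nth_mult_fps_exp_pochhammer:
  fixes x :: "'a::field_char_0"
  shows "fps_nth (A * fps_exp x) n =
    (\<Sum>l\<le>n. pochhammer x l / fact l * fps_nth (A * (1 - fps_exp (- 1)) ^ l) n)"
proof -
  define v :: "'a fps" where "v = 1 - fps_exp (- 1)"
  have v0: "fps_nth v 0 = 0"
    by (simp add: v_def)
  have "fps_nth (fps_exp x) i = (\<Sum>l\<le>n. pochhammer x l / fact l * fps_nth (v ^ l) i)"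
    if "i \<le> n" for i
  proof -
    have "fps_nth (fps_exp x) i = (\<Sum>l\<le>i. pochhammer x l / fact l * fps_nth (v ^ l) i)"
      by (subst fps_exp_eq_pochhammer_compose)
        (simp add: fps_compose_nth v_def atLeast0AtMost)
    \<comment> \<open>\<open>v ^ l\<close> has no term of degree below \<open>l\<close>, so the
      added terms vanish. A bound independent of \<open>i\<close> lets the two sums be swapped
      below.\<close>
    also have "\<dots> = (\<Sum>l\<le>n. pochhammer x l / fact l * fps_nth (v ^ l) i)"
      using that by (intro sum.mono_neutral_left) (auto simp: startsby_zero_power_prefix [OF v0])
    finally show ?thesis .
  qed
  then have "fps_nth (A * fps_exp x) n =
      (\<Sum>j=0..n. fps_nth A j * (\<Sum>l\<le>n. pochhammer x l / fact l * fps_nth (v ^ l) (n - j)))"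
    unfolding fps_mult_nth by simp
  also have "\<dots> = (\<Sum>l\<le>n. pochhammer x l / fact l * fps_nth (A * v ^ l) n)"
    unfolding fps_mult_nth sum_distrib_left
    by (subst sum.swap) (simp add: mult_ac)
  finally show ?thesis
    by (simp add: v_def)
qed

text \<open>The factor \<open>fps_exp (- of_nat l)\<close> is the source of the argument -l of the
  Euler polynomials in the theorem.\<close>

lemma one_minus_fps_exp_power:
  "fps_const (1 / fact l) * (1 - fps_exp (- 1)) ^ l =
     Abs_fps (\<lambda>i. of_nat (Stirling i l) / fact i) * fps_exp (- of_nat l :: 'a::field_char_0)"
proof -
  have "(1 - fps_exp (- 1) :: 'a fps) = (fps_exp 1 - 1) * fps_exp (- 1)"
    by (simp add: left_diff_distrib fps_exp_add_mult [symmetric])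
  then have "(1 - fps_exp (- 1) :: 'a fps) ^ l = (fps_exp 1 - 1) ^ l * fps_exp (- of_nat l)"
    by (simp add: power_mult_distrib fps_exp_power_mult)
  then show ?thesis
    by (simp add: Stirling_generating_function [symmetric] mult.assoc)
qed

theorem theorem4:
  fixes p q :: real and k :: int and n :: nat and x :: "'a::real_normed_field"
  assumes "0 < q" and "q < p" and "p \<le> 1"
  shows "(\<lambda>l. \<Sum>i=l..n. of_nat (n choose i) * of_nat (Stirling i l)
              * pq_poly_Euler k p q (n - i) (- of_nat l) * pochhammer x l)
         sums pq_poly_Euler k p q n x"
proof -
  define A :: "'a fps" where
    "A = 2 * (pq_polylog k p q oo (1 - fps_exp (- 1))) / (1 + fps_exp 1)"
  have E: "pq_poly_Euler k p q m y = fact m * fps_nth (A * fps_exp y) m" for m and y :: 'a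
    by (simp add: pq_poly_Euler_def pq_poly_Euler_gf_def A_def)
  let ?f = "\<lambda>l. \<Sum>i=l..n. of_nat (n choose i) * of_nat (Stirling i l)
              * pq_poly_Euler k p q (n - i) (- of_nat l) * pochhammer x l"
  have f: "?f l = fact n * (pochhammer x l / fact l * fps_nth (A * (1 - fps_exp (- 1)) ^ l) n)"
    for l
  proof -
    let ?S = "Abs_fps (\<lambda>i. of_nat (Stirling i l) / fact i) :: 'a fps"
    \<comment> \<open>\<open>Stirling i l\<close> is 0 for \<open>i < l\<close>; starting at 0 makes
      the sum a Cauchy product.\<close>
    have "?f l = (\<Sum>i=0..n. of_nat (n choose i) * of_nat (Stirling i l)
              * pq_poly_Euler k p q (n - i) (- of_nat l) * pochhammer x l)"
      by (rule sum.mono_neutral_left) auto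
    also have "\<dots> = (\<Sum>i=0..n. fact n * pochhammer x l *
        (fps_nth ?S i * fps_nth (A * fps_exp (- of_nat l)) (n - i)))"
      by (rule sum.cong) (auto simp: E binomial_fact)
    also have "\<dots> = fact n * pochhammer x l * fps_nth (?S * (A * fps_exp (- of_nat l))) n"
      by (simp only: fps_mult_nth [of ?S] sum_distrib_left)
    also have "?S * (A * fps_exp (- of_nat l)) = A * (?S * fps_exp (- of_nat l))"
      by (simp only: mult_ac)
    also have "\<dots> = fps_const (1 / fact l) * (A * (1 - fps_exp (- 1)) ^ l)"
      unfolding one_minus_fps_exp_power [symmetric] by (simp only: mult_ac)
    finally show ?thesis
      by simp
  qed
  \<comment> \<open>For \<open>l > n\<close> the range \<open>{l..n}\<close> is empty, so the series
    is a finite sum.\<close>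
  have "?f sums (\<Sum>l\<le>n. ?f l)"
    by (rule sums_finite) auto
  also have "(\<Sum>l\<le>n. ?f l) = pq_poly_Euler k p q n x"
    by (simp only: f E [of n x] fps_nth_mult_fps_exp_pochhammer [of A x] sum_distrib_left)
  finally show ?thesis .
qed

end
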